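(* Let $\Bbbk$ be an algebraically closed field of characteristic zero and let $B=[b_{rs}]$ be an $n\times 2$ integer matrix of rank $2$ with rows $b_1,\dots,b_n$. Let $I(B)=\langle x^{\mu_+}-x^{\mu_-} \mid \mu \text{ a column of } B\rangle\subseteq \Bbbk[x_1,\dots,x_n]$. Suppose that $b_i$ and $b_j$ ($i\neq j$) are linearly dependent rows of $B$ lying in opposite open quadrants of $\mathbb{Z}^2$, and without loss of generality assume $b_{i1},b_{i2}>0$. Let $d=\gcd(b_{i1},b_{i2})$ and write $\lambda=-b_{j1}/b_{i1}=-b_{j2}/b_{i2}>0$. Then the primary component of $I(B)$ corresponding to the associated prime $\langle x_i,x_j\rangle$ is \[ \Big(I(B):\big(\textstyle\prod_{k\neq i,j}x_k\big)^\infty\Big)+\big\langle x_j^{\lambda(b_{i1}+b_{i2}-d)},\ x_i^{d}x_j^{\lambda(b_{i1}+b_{i2}-2d)},\ x_i^{2d}x_j^{\lambda(b_{i1}+b_{i2}-3d)},\ \dots,\ x_i^{b_{i1}+b_{i2}-d}\big\rangle . \] Moreover, the only monomials in this ideal are those in $\langle x_j^{\lambda(b_{i1}+b_{i2}-d)}, x_i^{d}x_j^{\lambda(b_{i1}+b_{i2}-2d)},\dots,x_i^{b_{i1}+b_{i2}-d}\rangle$.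
   Context: For $\mu\in\mathbb{Z}^n$, $\mu_+,\mu_-\in\mathbb{N}^n$ are defined by $(\mu_+)_k=\max(\mu_k,0)$, $(\mu_-)_k=\max(-\mu_k,0)$, so $\mu=\mu_+-\mu_-$; $x^u=x_1^{u_1}\cdots x_n^{u_n}$. The monomial generators are $x_i^{kd}x_j^{\lambda(b_{i1}+b_{i2}-(k+1)d)}$ for $k=0,1,\dots,(b_{i1}+b_{i2}-d)/d$. $(J:f^\infty)$ denotes the saturation $\{g \mid f^m g\in J \text{ for some } m\}$. *)

theory Defs
  imports "HOL-Library.Poly_Mapping" "HOL-Computational_Algebra.Polynomial"
begin

type_synonym 'k mpoly = "(nat \<Rightarrow>\<^sub>0 nat) \<Rightarrow>\<^sub>0 'k"

definition polyring :: "nat \<Rightarrow> ('k::comm_ring_1) mpoly set" where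
  "polyring n = {p. \<forall>m \<in> Poly_Mapping.keys p. \<forall>v \<in> Poly_Mapping.keys m. v < n}"

definition monom :: "(nat \<Rightarrow>\<^sub>0 nat) \<Rightarrow> ('k::comm_ring_1) mpoly" where
  "monom u = Poly_Mapping.single u 1"

definition var :: "nat \<Rightarrow> ('k::comm_ring_1) mpoly" where
  "var i = monom (Poly_Mapping.single i 1)"

definition gen_ideal :: "nat \<Rightarrow> ('k::comm_ring_1) mpoly set \<Rightarrow> 'k mpoly set" where
  "gen_ideal n S = {f. \<exists>A c. finite A \<and> A \<subseteq> S \<and> (\<forall>g\<in>A. c g \<in> polyring n)
                          \<and> f = (\<Sum>g\<in>A. c g * g)}"

definition ideal_sum :: "('k::comm_ring_1) mpoly set \<Rightarrow> 'k mpoly set \<Rightarrow> 'k mpoly set" where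
  "ideal_sum I J = {a + b | a b. a \<in> I \<and> b \<in> J}"

definition saturation :: "nat \<Rightarrow> ('k::comm_ring_1) mpoly set \<Rightarrow> 'k mpoly \<Rightarrow> 'k mpoly set" where
  "saturation n J f = {g \<in> polyring n. \<exists>m::nat. f ^ m * g \<in> J}"

text \<open>The P-primary component of I for a minimal prime P: I R_P \<inter> R.\<close>
definition primary_component :: "nat \<Rightarrow> ('k::comm_ring_1) mpoly set \<Rightarrow> 'k mpoly set \<Rightarrow> 'k mpoly set" where
  "primary_component n I P = {f \<in> polyring n. \<exists>s \<in> polyring n. s \<notin> P \<and> s * f \<in> I}"

definition pos_part :: "nat \<Rightarrow> (nat \<Rightarrow> int) \<Rightarrow> nat \<Rightarrow>\<^sub>0 nat" where
  "pos_part n \<mu> = (\<Sum>k<n. Poly_Mapping.single k (nat (\<mu> k)))"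

definition neg_part :: "nat \<Rightarrow> (nat \<Rightarrow> int) \<Rightarrow> nat \<Rightarrow>\<^sub>0 nat" where
  "neg_part n \<mu> = (\<Sum>k<n. Poly_Mapping.single k (nat (- \<mu> k)))"

definition lattice_basis_ideal :: "nat \<Rightarrow> (nat \<Rightarrow> nat \<Rightarrow> int) \<Rightarrow> ('k::comm_ring_1) mpoly set" where
  "lattice_basis_ideal n b = gen_ideal n
     {monom (pos_part n (\<lambda>r. b r c)) - monom (neg_part n (\<lambda>r. b r c)) | c. c < (2::nat)}"

definition rank2 :: "nat \<Rightarrow> (nat \<Rightarrow> nat \<Rightarrow> int) \<Rightarrow> bool" where
  "rank2 n b \<longleftrightarrow> (\<forall>c0 c1 :: rat. (\<forall>r<n. c0 * of_int (b r 0) + c1 * of_int (b r 1) = 0)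
                        \<longrightarrow> c0 = 0 \<and> c1 = 0)"

definition alg_closed :: "'k::field itself \<Rightarrow> bool" where
  "alg_closed _ \<longleftrightarrow> (\<forall>p :: 'k poly. degree p \<ge> 1 \<longrightarrow> (\<exists>x. poly p x = 0))"

end

theory Submission
  imports Defs
begin

text \<open>
  Write the two rows as \<open>b\<^sub>i = d (p, q)\<close> and \<open>b\<^sub>j = - e (p, q)\<close> with \<open>p, q\<close> coprime, so that
  the generators of \<open>I(B)\<close> become \<open>x\<^sup>p m\<^sub>1 - y\<^sup>p m\<^sub>2\<close> and \<open>x\<^sup>q m\<^sub>3 - y\<^sup>q m\<^sub>4\<close> with \<open>x = x\<^sub>i\<^sup>d\<close>, \<open>y = x\<^sub>j\<^sup>e\<close>
  and the \<open>m\<^sub>k\<close> monomials in the other variables, and the monomial generators are those of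
  \<open>(x, y)\<^bsup>p + q - 1\<^esup>\<close>. Up to units in the other variables, the generators identify
  \<open>x\<^sup>c y\<^bsup>t - c\<^esup>\<close> with the monomials for \<open>c + p\<close> and \<open>c + q\<close>. In degree \<open>t < p + q - 1\<close>
  these moves on \<open>{0, \<dots>, t}\<close> form a forest, since \<open>p\<close> and \<open>q\<close> are coprime. The quotient is
  therefore torsion-free over the polynomials in the other variables, and no monomial of such a degree
  dies. In degree \<open>p + q - 1\<close> the moves form a single cycle; going around it multiplies
  by a Laurent monomial which is not \<open>1\<close> because \<open>B\<close> has rank two, so every monomial of that degree is
  annihilated by a binomial in the other variables.
\<close>

abbreviation lookup :: "('a \<Rightarrow>\<^sub>0 'b::zero) \<Rightarrow> 'a \<Rightarrow> 'b" where
  "lookup \<equiv> Poly_Mapping.lookup"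
abbreviation single :: "'a \<Rightarrow> 'b \<Rightarrow> ('a \<Rightarrow>\<^sub>0 'b::zero)" where
  "single \<equiv> Poly_Mapping.single"
abbreviation keys :: "('a \<Rightarrow>\<^sub>0 'b::zero) \<Rightarrow> 'a set" where
  "keys \<equiv> Poly_Mapping.keys"

section \<open>Polynomials and ideals\<close>

definition exps :: "nat \<Rightarrow> (nat \<Rightarrow>\<^sub>0 nat) set" where
  "exps n = {u. keys u \<subseteq> {..<n}}"

lemma exps_iff: "u \<in> exps n \<longleftrightarrow> (\<forall>v\<ge>n. lookup u v = 0)"
proof -
  have "u \<in> exps n \<longleftrightarrow> (\<forall>v. lookup u v \<noteq> 0 \<longrightarrow> v < n)"
    unfolding exps_def by (simp add: subset_eq Ball_def in_keys_iff)
  also have "\<dots> \<longleftrightarrow> (\<forall>v\<ge>n. lookup u v = 0)"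
    using linorder_not_le by blast
  finally show ?thesis .
qed

lemma exps_add_iff [simp]: "u + v \<in> exps n \<longleftrightarrow> u \<in> exps n \<and> v \<in> exps n"
  by (auto simp: exps_iff lookup_add)

lemma exps_zero [simp]: "0 \<in> exps n"
  by (simp add: exps_iff)

lemma exps_single [simp]: "v < n \<Longrightarrow> single v c \<in> exps n"
  by (simp add: exps_iff lookup_single when_def)

lemma polyring_iff: "p \<in> polyring n \<longleftrightarrow> keys p \<subseteq> exps n"
  unfolding polyring_def exps_def by auto

lemma polyring_zero [simp]: "0 \<in> polyring n"
  by (simp add: polyring_iff)

lemma polyring_single [simp]: "u \<in> exps n \<Longrightarrow> single u c \<in> polyring n"
  by (simp add: polyring_iff)

lemma polyring_monom [simp]: "u \<in> exps n \<Longrightarrow> monom u \<in> polyring n"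
  by (simp add: monom_def)

lemma keys_uminus_eq: "keys (- p) = keys (p :: 'a \<Rightarrow>\<^sub>0 'b::ab_group_add)"
  by (auto simp: in_keys_iff)

lemma polyring_add [simp]: "p \<in> polyring n \<Longrightarrow> q \<in> polyring n \<Longrightarrow> p + q \<in> polyring n"
  using Poly_Mapping.keys_add[of p q] by (auto simp: polyring_iff)

lemma polyring_uminus [simp]: "p \<in> polyring n \<Longrightarrow> - p \<in> polyring n"
  unfolding polyring_iff by (simp add: keys_uminus_eq)

lemma polyring_diff [simp]: "p \<in> polyring n \<Longrightarrow> q \<in> polyring n \<Longrightarrow> p - q \<in> polyring n"
  unfolding diff_conv_add_uminus by (intro polyring_add polyring_uminus)

lemma polyring_mult [simp]: "p \<in> polyring n \<Longrightarrow> q \<in> polyring n \<Longrightarrow> p * q \<in> polyring n"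
proof -
  assume "p \<in> polyring n" "q \<in> polyring n"
  then have "{a + b | a b. a \<in> keys p \<and> b \<in> keys q} \<subseteq> exps n"
    by (auto simp: polyring_iff)
  then show ?thesis
    using Poly_Mapping.keys_mult[of p q] by (simp add: polyring_iff)
qed

lemma polyring_sum: "(\<And>x. x \<in> A \<Longrightarrow> f x \<in> polyring n) \<Longrightarrow> sum f A \<in> polyring n"
  by (induction A rule: infinite_finite_induct) auto

lemma monom_zero [simp]: "monom 0 = 1"
  by (simp add: monom_def)

lemma monom_add: "monom (u + v) = monom u * monom v"
  by (simp add: monom_def mult_single)

lemma monom_sum: "finite A \<Longrightarrow> monom (sum f A) = (\<Prod>x\<in>A. monom (f x))"
  by (induction A rule: finite_induct) (auto simp: monom_add)

lemma monom_single_power: "monom (single v k) = var v ^ k"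
proof (induction k)
  case (Suc k)
  have "single v (Suc k) = single v 1 + single v k"
    by (simp flip: single_add)
  then show ?case using Suc by (simp add: monom_add var_def)
qed simp

lemma gen_ideal_zero [simp]: "0 \<in> gen_ideal n S"
  unfolding gen_ideal_def by (auto intro!: exI[of _ "{}"])

lemma gen_ideal_scaled_gen: "c \<in> polyring n \<Longrightarrow> g \<in> S \<Longrightarrow> c * g \<in> gen_ideal n S"
  unfolding gen_ideal_def by (auto intro!: exI[of _ "{g}"] exI[of _ "\<lambda>_. c"])

lemma gen_ideal_add [simp]:
  assumes "f \<in> gen_ideal n S" "g \<in> gen_ideal n S"
  shows "f + g \<in> gen_ideal n S"
proof -
  obtain A a where A: "finite A" "A \<subseteq> S" "\<forall>h\<in>A. a h \<in> polyring n" "f = (\<Sum>h\<in>A. a h * h)"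
    using assms(1) unfolding gen_ideal_def by blast
  obtain B b where B: "finite B" "B \<subseteq> S" "\<forall>h\<in>B. b h \<in> polyring n" "g = (\<Sum>h\<in>B. b h * h)"
    using assms(2) unfolding gen_ideal_def by blast
  \<comment> \<open>A generator may occur in both families but gets a single coefficient, so each
    family is extended by zero to the union.\<close>
  define c where "c h = (a h when h \<in> A) + (b h when h \<in> B)" for h
  have "f = (\<Sum>h\<in>A \<union> B. (a h when h \<in> A) * h)"
    unfolding A(4) using A(1) B(1) by (intro sum.mono_neutral_cong_left) auto
  moreover have "g = (\<Sum>h\<in>A \<union> B. (b h when h \<in> B) * h)"
    unfolding B(4) using A(1) B(1) by (intro sum.mono_neutral_cong_left) auto
  ultimately have "f + g = (\<Sum>h\<in>A \<union> B. c h * h)"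
    by (simp add: c_def distrib_right sum.distrib)
  moreover have "\<forall>h\<in>A \<union> B. c h \<in> polyring n"
    using A(3) B(3) by (auto simp: c_def when_def)
  ultimately show ?thesis
    using A(1,2) B(1,2) unfolding gen_ideal_def
    by (intro CollectI exI[of _ "A \<union> B"] exI[of _ c]) auto
qed

lemma gen_ideal_induct [consumes 1, case_names zero scaled_gen add]:
  assumes "f \<in> gen_ideal n S" and "P 0"
    and "\<And>c g. c \<in> polyring n \<Longrightarrow> g \<in> S \<Longrightarrow> P (c * g)"
    and "\<And>f g. P f \<Longrightarrow> P g \<Longrightarrow> P (f + g)"
  shows "P f"
proof -
  obtain A a where A: "finite A" "A \<subseteq> S" "\<forall>h\<in>A. a h \<in> polyring n" "f = (\<Sum>h\<in>A. a h * h)"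
    using assms(1) unfolding gen_ideal_def by blast
  have "P (\<Sum>h\<in>A. a h * h)"
    using A(1-3) by (induction A rule: finite_induct) (auto intro: assms(2-4))
  then show ?thesis using A(4) by simp
qed

lemma gen_ideal_mult:
  assumes "c \<in> polyring n" "f \<in> gen_ideal n S"
  shows "c * f \<in> gen_ideal n S"
  using assms(2)
proof (induction rule: gen_ideal_induct)
  case (scaled_gen a g)
  then show ?case
    using gen_ideal_scaled_gen[of "c * a" n g S] assms(1) by (simp add: mult.assoc)
qed (auto simp: distrib_left)

lemma gen_ideal_subset_polyring:
  assumes "S \<subseteq> polyring n" shows "gen_ideal n S \<subseteq> polyring n"
proof
  fix f assume "f \<in> gen_ideal n S"
  then show "f \<in> polyring n"
    by (induction rule: gen_ideal_induct) (use assms in auto)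
qed

section \<open>Sums of coefficients over sets of exponents\<close>

lemma poly_eq_sum_singles: "(\<Sum>u\<in>keys f. single u (lookup f u)) = f"
proof (rule poly_mapping_eqI)
  fix k
  show "lookup (\<Sum>u\<in>keys f. single u (lookup f u)) k = lookup f k"
    by (simp add: lookup_sum lookup_single when_def in_keys_iff)
qed

text \<open>A linear functional that serves as an obstruction to membership: for \<open>Q\<close> a
  class of \<open>eqv\<close> it vanishes on the saturation.\<close>

definition coeff_sum :: "('a \<Rightarrow> bool) \<Rightarrow> ('a \<Rightarrow>\<^sub>0 'b::comm_monoid_add) \<Rightarrow> 'b" where
  "coeff_sum Q f = (\<Sum>u\<in>keys f. lookup f u when Q u)"

lemma coeff_sum_superset:
  "finite K \<Longrightarrow> keys f \<subseteq> K \<Longrightarrow> coeff_sum Q f = (\<Sum>u\<in>K. lookup f u when Q u)"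
  unfolding coeff_sum_def by (intro sum.mono_neutral_left) (auto simp: in_keys_iff)

text \<open>Cancellation can shrink the support of a sum, hence the three sums are compared over a
  common finite set.\<close>

lemma coeff_sum_add: "coeff_sum Q (f + g) = coeff_sum Q f + coeff_sum Q g"
proof -
  let ?K = "keys f \<union> keys g"
  have "coeff_sum Q h = (\<Sum>u\<in>?K. lookup h u when Q u)" if "h \<in> {f, g, f + g}" for h
    using that Poly_Mapping.keys_add[of f g] by (intro coeff_sum_superset) auto
  from this[of f] this[of g] this[of "f + g"] show ?thesis
    by (simp add: lookup_add when_add_distrib sum.distrib)
qed

lemma coeff_sum_zero [simp]: "coeff_sum Q 0 = 0"
  by (simp add: coeff_sum_def)

lemma coeff_sum_single [simp]: "coeff_sum Q (single u c) = (c when Q u)"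
  by (cases "c = 0") (simp_all add: coeff_sum_def)

lemma coeff_sum_uminus: "coeff_sum Q (- f) = - coeff_sum Q (f :: 'a \<Rightarrow>\<^sub>0 'b::ab_group_add)"
proof -
  have "coeff_sum Q f + coeff_sum Q (- f) = 0"
    using coeff_sum_add[of Q f "- f"] by (simp only: add.right_inverse coeff_sum_zero)
  then show ?thesis by (rule minus_unique[symmetric])
qed

lemma coeff_sum_diff:
  "coeff_sum Q (f - g) = coeff_sum Q f - coeff_sum Q (g :: 'a \<Rightarrow>\<^sub>0 'b::ab_group_add)"
  using coeff_sum_add[of Q f "- g"] by (simp only: coeff_sum_uminus diff_conv_add_uminus)

lemma coeff_sum_sum: "coeff_sum Q (\<Sum>x\<in>A. f x) = (\<Sum>x\<in>A. coeff_sum Q (f x))"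
  by (induction A rule: infinite_finite_induct) (auto simp: coeff_sum_add)

lemma coeff_sum_mult:
  fixes f g :: "'a::comm_monoid_add \<Rightarrow>\<^sub>0 'b::comm_semiring_1"
  shows "coeff_sum Q (f * g) =
    (\<Sum>w\<in>keys f. \<Sum>u\<in>keys g. lookup f w * lookup g u when Q (w + u))"
proof -
  have "f * g = (\<Sum>w\<in>keys f. single w (lookup f w)) * (\<Sum>u\<in>keys g. single u (lookup g u))"
    by (simp only: poly_eq_sum_singles)
  also have "\<dots> = (\<Sum>w\<in>keys f. \<Sum>u\<in>keys g. single (w + u) (lookup f w * lookup g u))"
    unfolding sum_product mult_single ..
  finally show ?thesis by (simp only: coeff_sum_sum coeff_sum_single)
qed

lemma coeff_sum_single_mult:
  fixes g :: "'a::comm_monoid_add \<Rightarrow>\<^sub>0 'b::comm_semiring_1"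
  shows "coeff_sum Q (single w c * g) = c * coeff_sum (\<lambda>u. Q (w + u)) g"
proof (cases "c = 0")
  case False
  then show ?thesis
    unfolding coeff_sum_mult by (simp add: coeff_sum_def sum_distrib_left mult_when)
qed simp

lemma coeff_sum_cong: "(\<And>u. u \<in> keys f \<Longrightarrow> Q u = R u) \<Longrightarrow> coeff_sum Q f = coeff_sum R f"
  unfolding coeff_sum_def by (intro sum.cong) auto

lemma coeff_sum_eq_0: "(\<And>u. u \<in> keys f \<Longrightarrow> \<not> Q u) \<Longrightarrow> coeff_sum Q f = 0"
  unfolding coeff_sum_def by (intro sum.neutral) auto

lemma gen_ideal_sum:
  "(\<And>x. x \<in> A \<Longrightarrow> f x \<in> gen_ideal n S) \<Longrightarrow> sum f A \<in> gen_ideal n S"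
  by (induction A rule: infinite_finite_induct) auto

lemma gen_ideal_uminus:
  assumes "f \<in> gen_ideal n S" shows "- f \<in> gen_ideal n S"
proof -
  have "- 1 \<in> polyring n"
    using polyring_uminus[OF polyring_single[of 0 n 1]] by simp
  from gen_ideal_mult[OF this assms] show ?thesis by simp
qed

lemma single_eq_mult_monom: "single (w + v) c = single w c * monom v"
  by (simp add: monom_def mult_single)

text \<open>All keys of \<open>c * monom v\<close> are multiples of \<open>v\<close>; conversely a
  polynomial is the sum of its terms. This serves for the corner ideal and for \<open>P\<close>
  alike.\<close>

lemma monomial_ideal_iff:
  assumes "U \<subseteq> exps n"
  shows "f \<in> gen_ideal n (monom ` U) \<longleftrightarrow>
    f \<in> polyring n \<and> (\<forall>u\<in>keys f. \<exists>v\<in>U. \<exists>w. u = w + v)"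
proof
  assume f: "f \<in> gen_ideal n (monom ` U)"
  have "monom ` U \<subseteq> polyring n"
    using assms by auto
  then have "f \<in> polyring n"
    using f gen_ideal_subset_polyring by blast
  moreover have "\<forall>u\<in>keys f. \<exists>v\<in>U. \<exists>w. u = w + v"
    using f
  proof (induction rule: gen_ideal_induct)
    case (scaled_gen c g)
    then obtain v where v: "v \<in> U" "g = monom v"
      by auto
    have "keys (monom v :: 'a mpoly) \<subseteq> {v}"
      by (simp add: monom_def)
    then show ?case
      using Poly_Mapping.keys_mult[of c g] v by blast
  next
    case (add f g)
    then show ?case
      using Poly_Mapping.keys_add[of f g] by blast
  qed simp
  ultimately show "f \<in> polyring n \<and> (\<forall>u\<in>keys f. \<exists>v\<in>U. \<exists>w. u = w + v)"
    by simp
next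
  assume f: "f \<in> polyring n \<and> (\<forall>u\<in>keys f. \<exists>v\<in>U. \<exists>w. u = w + v)"
  have "single u (lookup f u) \<in> gen_ideal n (monom ` U)" if "u \<in> keys f" for u
  proof -
    obtain v w where vw: "v \<in> U" "u = w + v"
      using f \<open>u \<in> keys f\<close> by blast
    have "u \<in> exps n"
      using f \<open>u \<in> keys f\<close> unfolding polyring_iff by blast
    then have "single w (lookup f u) \<in> polyring n"
      unfolding vw(2) by simp
    then show ?thesis
      unfolding vw(2) single_eq_mult_monom using vw(1) by (intro gen_ideal_scaled_gen) auto
  qed
  then have "(\<Sum>u\<in>keys f. single u (lookup f u)) \<in> gen_ideal n (monom ` U)"
    by (rule gen_ideal_sum)
  then show "f \<in> gen_ideal n (monom ` U)"
    by (simp only: poly_eq_sum_singles)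
qed

lemma lookup_pos_part: "lookup (pos_part n \<mu>) v = (if v < n then nat (\<mu> v) else 0)"
  by (simp add: pos_part_def lookup_sum lookup_single when_def)

lemma lookup_neg_part: "lookup (neg_part n \<mu>) v = (if v < n then nat (- \<mu> v) else 0)"
  by (simp add: neg_part_def lookup_sum lookup_single when_def)

text \<open>Solutions of \<open>x p + y q = z\<close> differ by multiples of
  \<open>(q, - p)\<close>, which shift \<open>x - y\<close> by multiples of \<open>p + q\<close>; an
  open window of that length holds at most one.\<close>

lemma coprime_window_unique:
  fixes x y x' y' p q :: int
  assumes "coprime p q" "p > 0" "q > 0" "x * p + y * q = x' * p + y' * q"
    and "0 < x - y" "x - y < p + q" "0 < x' - y'" "x' - y' < p + q"
  shows "x = x' \<and> y = y'"
proof -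
  have eq: "(x - x') * p = (y' - y) * q"
    using assms(4) by (simp add: algebra_simps)
  have "q dvd (x - x') * p"
    unfolding eq by simp
  then have "q dvd x - x'"
    using assms(1) by (simp add: coprime_commute coprime_dvd_mult_left_iff)
  then obtain t where t: "x - x' = q * t" ..
  have "p dvd (y' - y) * q"
    unfolding eq[symmetric] by simp
  then have "p dvd y' - y"
    using assms(1) by (simp add: coprime_dvd_mult_left_iff)
  then obtain t' where t': "y' - y = p * t'" ..
  have t_eq: "t = t'"
    using eq assms(2,3) unfolding t t' by (simp add: algebra_simps)
  have "(x - y) - (x' - y') = (p + q) * t"
    using t t' unfolding t_eq by (simp add: algebra_simps)
  moreover have "\<bar>(x - y) - (x' - y')\<bar> < p + q"
    using assms(5-8) by linarith
  ultimately have "(p + q) * \<bar>t\<bar> < (p + q) * 1"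
    using assms(2,3) by (simp add: abs_mult)
  then have "\<bar>t\<bar> < 1"
    using assms(2,3) by (simp only: mult_less_cancel_left_pos add_pos_pos)
  then show ?thesis using t t' t_eq by simp
qed

text \<open>A Bezout solution is moved along \<open>(q, - p)\<close> until \<open>x - y\<close> is
  reduced modulo \<open>p + q\<close>. Residue zero would make \<open>z\<close> a multiple of
  \<open>p + q\<close>, which the bounds on \<open>z\<close> exclude.\<close>

lemma coprime_window_exists:
  fixes p q z :: int
  assumes "coprime p q" "p > 0" "q > 0" "0 < z" "z < p + q"
  obtains x y where "x * p + y * q = z" "0 < x - y" "x - y < p + q"
proof -
  obtain x0 y0 where xy0: "x0 * p + y0 * q = 1"
    using bezout_int[of p q] assms(1) by (auto simp: coprime_iff_gcd_eq_1)
  define t where "t = (x0 * z - y0 * z) div (p + q)"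
  define x y where "x = x0 * z - t * q" and "y = y0 * z + t * p"
  have z: "x * p + y * q = z"
    using arg_cong[OF xy0, of "\<lambda>w. w * z"] by (simp add: x_def y_def algebra_simps)
  have diff: "x - y = (x0 * z - y0 * z) mod (p + q)"
    unfolding x_def y_def t_def minus_div_mult_eq_mod[symmetric] by (simp add: algebra_simps)
  have "x - y \<noteq> 0"
  proof
    assume "x - y = 0"
    then have "z = x * (p + q)"
      using z by (simp add: algebra_simps)
    moreover from this have "0 < x"
      using assms by (simp add: zero_less_mult_iff)
    ultimately have "p + q \<le> z"
      using assms by (simp add: mult_le_cancel_right1)
    then show False using assms by simp
  qed
  moreover have "0 \<le> x - y" "x - y < p + q"
    unfolding diff using assms by simp_all
  ultimately show ?thesis
    using that z by simp
qed

lemma finite_obtains_max: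
  fixes f :: "'a \<Rightarrow> 'b::linorder"
  assumes "finite A" "A \<noteq> {}"
  obtains x where "x \<in> A" "\<And>y. y \<in> A \<Longrightarrow> f y \<le> f x"
proof -
  have "Max (f ` A) \<in> f ` A"
    using assms by (intro Max_in) auto
  then obtain x where "x \<in> A" "Max (f ` A) = f x"
    by auto
  moreover have "f y \<le> Max (f ` A)" if "y \<in> A" for y
    using assms that by (intro Max_ge) auto
  ultimately show ?thesis
    using that by metis
qed

section \<open>Moves between monomials\<close>

text \<open>Integer exponents make room for the negative entries of \<open>shifted\<close>; the
  linear order on them is compatible with addition.\<close>

definition int_exp :: "('a \<Rightarrow>\<^sub>0 nat) \<Rightarrow> ('a \<Rightarrow>\<^sub>0 int)" where
  "int_exp = Poly_Mapping.map int"

lemma lookup_int_exp [simp]: "lookup (int_exp w) v = int (lookup w v)"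
  by (simp add: int_exp_def map.rep_eq when_def)

lemma int_exp_eq_iff [simp]: "int_exp w = int_exp w' \<longleftrightarrow> w = w'"
  by (simp add: poly_mapping_eq_iff fun_eq_iff)

text \<open>Here \<open>e / d\<close> is the \<open>lambda\<close> of the theorem, so that all
  exponents are natural numbers.\<close>

locale opposite_rows =
  fixes n i j :: nat and b :: "nat \<Rightarrow> nat \<Rightarrow> int" and d e p q :: nat
  assumes i_less: "i < n" and j_less: "j < n" and i_neq_j: "i \<noteq> j"
    and pos: "d > 0" "e > 0" "p > 0" "q > 0"
    and coprime_pq: "coprime p q"
    and row_i: "b i 0 = int (d * p)" "b i 1 = int (d * q)"
    and row_j: "b j 0 = - int (e * p)" "b j 1 = - int (e * q)"
    and rank: "rank2 n b"
begin

text \<open>These monomials become units on localising at the prime of \<open>x_i\<close> and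
  \<open>x_j\<close>.\<close>

definition others :: "(nat \<Rightarrow>\<^sub>0 nat) set" where
  "others = {w \<in> exps n. lookup w i = 0 \<and> lookup w j = 0}"

definition up :: "nat \<Rightarrow> nat \<Rightarrow>\<^sub>0 nat" where
  "up c = pos_part n (\<lambda>r. b r c)"

definition down :: "nat \<Rightarrow> nat \<Rightarrow>\<^sub>0 nat" where
  "down c = neg_part n (\<lambda>r. b r c)"

text \<open>The binomial of an edge is a monomial multiple of a generator, and these binomials span
  the ideal linearly.\<close>

definition edge :: "(nat \<Rightarrow>\<^sub>0 nat) \<Rightarrow> (nat \<Rightarrow>\<^sub>0 nat) \<Rightarrow> bool" where
  "edge u v \<longleftrightarrow> (\<exists>c<2. \<exists>w\<in>exps n. u = w + up c \<and> v = w + down c)"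

text \<open>The degree in \<open>x\<close> and \<open>y\<close>. Rounding down is harmless since a
  move changes the exponents of \<open>x_i\<close> and \<open>x_j\<close> by multiples of
  \<open>d\<close> and \<open>e\<close>.\<close>

definition level :: "(nat \<Rightarrow>\<^sub>0 nat) \<Rightarrow> nat" where
  "level u = lookup u i div d + lookup u j div e"

text \<open>A grading for which both generators are homogeneous: \<open>x_i^d\<close> and
  \<open>x_j^e\<close> both have degree \<open>d e\<close>, the other variables degree zero.\<close>

definition weight :: "(nat \<Rightarrow>\<^sub>0 nat) \<Rightarrow> nat" where
  "weight u = e * lookup u i + d * lookup u j"

definition step :: "nat \<Rightarrow> nat" where
  "step c = (if c = 0 then p else q)"

text \<open>
  Level \<open>p + q - 2\<close> has positions \<open>c = 0, \<dots>, p + q - 2\<close>, and the moves \<open>c \<mapsto> c + p\<close>,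
  \<open>c \<mapsto> c + q\<close> join them to a path. The potential counts the two kinds of moves along it:
  outside this range of \<open>c\<close> the choice may be over an empty set.
\<close>

definition potential :: "nat \<Rightarrow> int \<times> int" where
  "potential c = (SOME (x, y). x * int p + y * int q = int c + 1 \<and> 0 < x - y \<and> x - y < int (p + q))"

text \<open>
  This is \<open>u - B \<kappa>\<close> for the potential \<open>\<kappa>\<close> of \<open>u\<close>: an edge changes \<open>u\<close> by a column of \<open>B\<close>, so it is
  constant along edges of low level. The entries may be negative.
\<close>

definition shifted :: "(nat \<Rightarrow>\<^sub>0 nat) \<Rightarrow> (nat \<Rightarrow>\<^sub>0 int)" where
  "shifted u = Abs_poly_mapping (\<lambda>v. int (lookup u v) -
     (if v < n then fst (potential (lookup u i div d)) * b v 0 + snd (potential (lookup u i div d)) * b v 1 else 0))"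

lemma others_add_iff [simp]: "u + v \<in> others \<longleftrightarrow> u \<in> others \<and> v \<in> others"
  by (auto simp: others_def lookup_add)

lemma others_zero [simp]: "0 \<in> others"
  by (simp add: others_def)

lemma othersD: "w \<in> others \<Longrightarrow> w \<in> exps n" "w \<in> others \<Longrightarrow> lookup w i = 0" "w \<in> others \<Longrightarrow> lookup w j = 0"
  by (simp_all add: others_def)

lemma up_exps [simp]: "up c \<in> exps n" and down_exps [simp]: "down c \<in> exps n"
  by (simp_all add: exps_iff up_def down_def lookup_pos_part lookup_neg_part)

lemma lookup_up_down: "v < n \<Longrightarrow> int (lookup (up c) v) - int (lookup (down c) v) = b v c"
  by (simp add: up_def down_def lookup_pos_part lookup_neg_part)

lemma lookup_up_down_ij:
  assumes "c < 2"
  shows "lookup (up c) i = d * step c" "lookup (down c) i = 0"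
    "lookup (up c) j = 0" "lookup (down c) j = e * step c"
  using assms row_i row_j i_less j_less
  by (auto simp: up_def down_def lookup_pos_part lookup_neg_part step_def less_2_cases_iff
      nat_mult_distrib)

lemma edge_exps: "edge u v \<Longrightarrow> u \<in> exps n \<and> v \<in> exps n"
  by (auto simp: edge_def)

lemma edge_add: "edge u v \<Longrightarrow> w \<in> exps n \<Longrightarrow> edge (u + w) (v + w)"
proof -
  assume "edge u v" "w \<in> exps n"
  then obtain c x where "c < 2" "x \<in> exps n" "u = x + up c" "v = x + down c"
    unfolding edge_def by blast
  with \<open>w \<in> exps n\<close> show ?thesis
    unfolding edge_def by (intro exI[of _ c] conjI bexI[of _ "x + w"]) (simp_all add: ac_simps)
qed

lemma edge_level: "edge u v \<Longrightarrow> level u = level v"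
  using pos by (auto simp: edge_def level_def lookup_add lookup_up_down_ij)

lemma edge_weight: "edge u v \<Longrightarrow> weight u = weight v"
  by (auto simp: edge_def weight_def lookup_add lookup_up_down_ij algebra_simps)

section \<open>The potential along the path of positions\<close>

lemma potential_unique:
  assumes "x * int p + y * int q = int c + 1" "0 < x - y" "x - y < int (p + q)"
  shows "potential c = (x, y)"
  unfolding potential_def
proof (rule some_equality)
  show "case (x, y) of (x, y) \<Rightarrow> x * int p + y * int q = int c + 1 \<and> 0 < x - y \<and> x - y < int (p + q)"
    using assms by simp
next
  fix xy :: "int \<times> int"
  assume "case xy of (x, y) \<Rightarrow> x * int p + y * int q = int c + 1 \<and> 0 < x - y \<and> x - y < int (p + q)"
  then show "xy = (x, y)"
    using coprime_window_unique[of "int p" "int q" "fst xy" "snd xy" x y] assms coprime_pq pos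
    by (auto simp: prod_eq_iff)
qed

lemma potential_exists:
  assumes "c + 1 < p + q"
  obtains x y where "potential c = (x, y)" "x * int p + y * int q = int c + 1"
    "0 < x - y" "x - y < int (p + q)"
proof -
  obtain x y where "x * int p + y * int q = int c + 1" "0 < x - y" "x - y < int (p + q)"
    using coprime_window_exists[of "int p" "int q" "int c + 1"] coprime_pq pos assms by auto
  then show ?thesis using that potential_unique by blast
qed

text \<open>At either end of the window \<open>c + 1\<close> would be a multiple of
  \<open>p + q\<close>, impossible for \<open>0 < c + 1 < p + q\<close>. A move changes
  \<open>x - y\<close> by one and so cannot leave the closed window; this brings it back into the
  open one.\<close>

lemma no_solution_on_diagonal:
  fixes x y :: int and c :: nat
  assumes "x * int p + y * int q = int c + 1" "c + 1 < p + q" "0 \<le> x - y" "x - y \<le> int (p + q)"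
  shows "0 < x - y \<and> x - y < int (p + q)"
proof -
  have small: False if "int c + 1 = (int p + int q) * t" for t :: int
  proof -
    have "0 < (int p + int q) * t"
      unfolding that[symmetric] by simp
    then have "1 \<le> t"
      using pos by (simp add: zero_less_mult_iff)
    then have "(int p + int q) * 1 \<le> (int p + int q) * t"
      by (intro mult_left_mono) auto
    then have "int p + int q \<le> int c + 1"
      unfolding that by simp
    then show False
      using assms(2) by linarith
  qed
  have "x - y \<noteq> 0"
  proof
    assume "x - y = 0"
    then have "int c + 1 = (int p + int q) * x"
      using assms(1) by (simp add: algebra_simps)
    then show False by (rule small)
  qed
  moreover have "x - y \<noteq> int (p + q)"
  proof
    assume "x - y = int (p + q)"
    then have x: "x = y + int p + int q" by simp
    have "int c + 1 = (int p + int q) * (y + int p)"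
      using assms(1) unfolding x by (simp add: algebra_simps)
    then show False by (rule small)
  qed
  ultimately show ?thesis using assms by linarith
qed

lemma potential_add_p:
  assumes "c + p + 1 < p + q"
  shows "potential (c + p) = (fst (potential c) + 1, snd (potential c))"
proof -
  obtain x y where xy: "potential c = (x, y)" "x * int p + y * int q = int c + 1"
    "0 < x - y" "x - y < int (p + q)"
    using potential_exists[of c] assms by auto
  have "(x + 1) * int p + y * int q = int (c + p) + 1"
    using xy(2) by (simp add: algebra_simps)
  moreover from this have "0 < x + 1 - y \<and> x + 1 - y < int (p + q)"
    using assms xy by (intro no_solution_on_diagonal[of _ _ "c + p"]) auto
  ultimately show ?thesis
    using potential_unique xy(1) by simp
qed

lemma potential_add_q:
  assumes "c + q + 1 < p + q"
  shows "potential (c + q) = (fst (potential c), snd (potential c) + 1)"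
proof -
  obtain x y where xy: "potential c = (x, y)" "x * int p + y * int q = int c + 1"
    "0 < x - y" "x - y < int (p + q)"
    using potential_exists[of c] assms by auto
  have "x * int p + (y + 1) * int q = int (c + q) + 1"
    using xy(2) by (simp add: algebra_simps)
  moreover from this have "0 < x - (y + 1) \<and> x - (y + 1) < int (p + q)"
    using assms xy by (intro no_solution_on_diagonal[of _ _ "c + q"]) auto
  ultimately show ?thesis
    using potential_unique xy(1) by simp
qed

lemma lookup_shifted: "lookup (shifted u) v = int (lookup u v) -
     (if v < n then fst (potential (lookup u i div d)) * b v 0 + snd (potential (lookup u i div d)) * b v 1 else 0)"
proof -
  let ?f = "\<lambda>v. int (lookup u v) -
     (if v < n then fst (potential (lookup u i div d)) * b v 0 + snd (potential (lookup u i div d)) * b v 1 else 0)"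
  have "{v. ?f v \<noteq> 0} \<subseteq> keys u \<union> {..<n}"
    by (auto simp: in_keys_iff)
  then have "finite {v. ?f v \<noteq> 0}"
    by (rule finite_subset) simp
  then show ?thesis
    unfolding shifted_def by (subst lookup_Abs_poly_mapping) auto
qed

lemma shifted_edge:
  assumes "edge u v" "level u + 1 < p + q"
  shows "shifted u = shifted v"
proof -
  obtain c w where c: "c < 2" "w \<in> exps n" "u = w + up c" "v = w + down c"
    using assms(1) unfolding edge_def by blast
  define a where "a = lookup w i div d"
  have u: "lookup u i div d = a + step c" and v: "lookup v i div d = a"
    using pos c by (simp_all add: a_def lookup_add lookup_up_down_ij)
  \<comment> \<open>The position \<open>a + step c\<close> is at most the level, so the move stays
    where the potential follows it.\<close>
  have "a + step c + 1 < p + q"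
    using assms(2) u by (simp add: level_def)
  then have pot: "fst (potential (a + step c)) = fst (potential a) + (if c = 0 then 1 else 0)"
    "snd (potential (a + step c)) = snd (potential a) + (if c = 0 then 0 else 1)"
    using potential_add_p[of a] potential_add_q[of a] by (auto simp: step_def)
  show ?thesis
  proof (rule poly_mapping_eqI)
    fix r
    show "lookup (shifted u) r = lookup (shifted v) r"
    proof (cases "r < n")
      case True
      then have "int (lookup u r) = int (lookup v r) + b r c"
        using lookup_up_down[of r c] unfolding c by (simp add: lookup_add)
      then show ?thesis
        using True \<open>c < 2\<close> by (auto simp: lookup_shifted u v pot less_2_cases_iff algebra_simps)
    next
      case False
      then have "lookup u r = 0" "lookup v r = 0"
        using edge_exps[OF assms(1)] by (simp_all add: exps_iff)
      then show ?thesis using False by (simp add: lookup_shifted)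
    qed
  qed
qed

text \<open>The potential depends on the exponent of \<open>x_i\<close> only, which \<open>w\<close>
  leaves alone.\<close>

lemma shifted_add: "w \<in> others \<Longrightarrow> shifted (u + w) = shifted u + int_exp w"
  by (rule poly_mapping_eqI) (simp add: lookup_shifted lookup_add othersD)

lemma level_add: "w \<in> others \<Longrightarrow> level (u + w) = level u"
  by (simp add: level_def lookup_add othersD)

lemma weight_add: "weight (u + w) = weight u + weight w"
  by (simp add: weight_def lookup_add algebra_simps)

lemma others_iff_weight: "w \<in> exps n \<Longrightarrow> w \<in> others \<longleftrightarrow> weight w = 0"
  using pos by (simp add: others_def weight_def)

text \<open>Connectedness by edges in the ring where the other variables are inverted.\<close>

definition eqv :: "(nat \<Rightarrow>\<^sub>0 nat) \<Rightarrow> (nat \<Rightarrow>\<^sub>0 nat) \<Rightarrow> bool" where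
  "eqv u v \<longleftrightarrow> (\<exists>w\<in>others. equivclp edge (u + w) (v + w))"

lemma equivclp_edge_add:
  assumes "equivclp edge u v" "w \<in> exps n"
  shows "equivclp edge (u + w) (v + w)"
  using assms(1)
proof (induction rule: equivclp_induct)
  case (step y z)
  then have "edge (y + w) (z + w) \<or> edge (z + w) (y + w)"
    using edge_add[OF _ assms(2)] by blast
  with step.IH show ?case by (rule equivclp_into_equivclp)
qed simp

lemma eqv_refl [simp]: "eqv u u"
  unfolding eqv_def by (rule bexI[of _ 0]) auto

lemma eqv_sym: "eqv u v \<Longrightarrow> eqv v u"
  unfolding eqv_def by (auto dest: equivclp_sym)

lemma eqv_add:
  assumes "eqv u v" "w \<in> exps n"
  shows "eqv (u + w) (v + w)"
proof -
  obtain w' where "w' \<in> others" "equivclp edge (u + w') (v + w')"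
    using assms(1) unfolding eqv_def by blast
  then show ?thesis
    using equivclp_edge_add[of "u + w'" "v + w'" w] assms(2)
    unfolding eqv_def by (auto simp: ac_simps intro!: bexI[of _ w'])
qed

lemma eqv_trans [trans]:
  assumes "eqv u v" "eqv v x"
  shows "eqv u x"
proof -
  obtain w w' where w: "w \<in> others" "equivclp edge (u + w) (v + w)"
    "w' \<in> others" "equivclp edge (v + w') (x + w')"
    using assms unfolding eqv_def by blast
  \<comment> \<open>Each chain is multiplied by the monomial of the other, so that they meet at
    \<open>v + w + w'\<close>.\<close>
  have "equivclp edge (u + w + w') (v + w + w')"
    using w equivclp_edge_add othersD by blast
  moreover have "equivclp edge (v + w' + w) (x + w' + w)"
    using w equivclp_edge_add othersD by blast
  ultimately have "equivclp edge (u + (w + w')) (x + (w + w'))"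
    unfolding add.assoc add.commute[of w' w] by (rule equivclp_trans)
  then show ?thesis
    unfolding eqv_def using w by (auto intro!: bexI[of _ "w + w'"])
qed

lemma eqv_cancel:
  assumes "eqv (u + w) (v + w)" "w \<in> others"
  shows "eqv u v"
proof -
  obtain w' where "w' \<in> others" "equivclp edge (u + w + w') (v + w + w')"
    using assms(1) unfolding eqv_def by blast
  then show ?thesis
    using assms(2) unfolding eqv_def by (auto simp: add.assoc intro!: bexI[of _ "w + w'"])
qed

lemma eqv_cong: "eqv u v \<Longrightarrow> eqv a u \<longleftrightarrow> eqv a v"
  using eqv_trans[of a u v] eqv_trans[of a v u] eqv_sym[of u v] by blast

lemma edge_eqv: "edge u v \<Longrightarrow> eqv u v"
  unfolding eqv_def by (rule bexI[of _ 0]) auto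

lemma equivclp_edge_invariant:
  assumes "equivclp edge u v"
  shows "weight u = weight v \<and> level u = level v \<and> (u \<in> exps n \<longleftrightarrow> v \<in> exps n) \<and>
    (level u + 1 < p + q \<longrightarrow> shifted u = shifted v)"
  using assms
proof (induction rule: equivclp_induct)
  case (step y z)
  then show ?case
    using edge_weight[of y z] edge_level[of y z] edge_exps[of y z] shifted_edge[of y z]
      edge_weight[of z y] edge_level[of z y] edge_exps[of z y] shifted_edge[of z y] by auto
qed simp

text \<open>The multiplier in \<open>eqv\<close> has weight zero, does not affect the level and
  translates \<open>shifted\<close> equally on both sides, so the invariants of chains
  descend.\<close>

lemma eqv_invariant:
  assumes "eqv u v"
  shows eqv_weight: "weight u = weight v" and eqv_level: "level u = level v"
    and eqv_exps: "u \<in> exps n \<longleftrightarrow> v \<in> exps n"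
    and eqv_shifted: "level u + 1 < p + q \<Longrightarrow> shifted u = shifted v"
proof -
  obtain w where w: "w \<in> others" "equivclp edge (u + w) (v + w)"
    using assms unfolding eqv_def by blast
  from equivclp_edge_invariant[OF w(2)] w(1)
  show "weight u = weight v" "level u = level v" "u \<in> exps n \<longleftrightarrow> v \<in> exps n"
    "level u + 1 < p + q \<Longrightarrow> shifted u = shifted v"
    by (simp_all add: weight_add level_add shifted_add othersD)
qed

section \<open>The saturation and the monomial ideal\<close>

abbreviation LI :: "'k::field mpoly set" where
  "LI \<equiv> lattice_basis_ideal n b"

abbreviation sat :: "'k::field mpoly set" where
  "sat \<equiv> saturation n LI (\<Prod>k \<in> {..<n} - {i, j}. var k)"

abbreviation P :: "'k::field mpoly set" where
  "P \<equiv> gen_ideal n {var i, var j}"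

text \<open>The monomial \<open>x^c y^(p + q - 1 - c)\<close>, where \<open>p + q - 1\<close> is
  \<open>(b_i1 + b_i2 - d) / d\<close> in the notation of the theorem.\<close>

definition corner :: "nat \<Rightarrow> nat \<Rightarrow>\<^sub>0 nat" where
  "corner c = single i (c * d) + single j ((p + q - 1 - c) * e)"

definition corners :: "(nat \<Rightarrow>\<^sub>0 nat) set" where
  "corners = corner ` {..p + q - 1}"

abbreviation component :: "'k::field mpoly set" where
  "component \<equiv> ideal_sum sat (gen_ideal n (monom ` corners))"

definition others_exp :: "nat \<Rightarrow> nat \<Rightarrow>\<^sub>0 nat" where
  "others_exp l = (\<Sum>k\<in>{..<n} - {i, j}. single k l)"

lemma lookup_others_exp: "lookup (others_exp l) k = (if k \<in> {..<n} - {i, j} then l else 0)"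
  by (simp add: others_exp_def lookup_sum lookup_single when_def)

lemma others_exp_others: "others_exp l \<in> others"
  by (auto simp: others_def exps_iff lookup_others_exp)

lemma others_exp_add: "others_exp (k + l) = others_exp k + others_exp l"
  by (rule poly_mapping_eqI) (simp add: lookup_others_exp lookup_add)

lemma prod_var_power: "(\<Prod>k \<in> {..<n} - {i, j}. var k) ^ l = monom (others_exp l)"
  by (simp add: others_exp_def monom_sum monom_single_power prod_power_distrib)

section \<open>Binomials in the ideal and in its saturation\<close>

lemma LI_eq: "LI = gen_ideal n ((\<lambda>c. monom (up c) - monom (down c)) ` {..<2})"
  unfolding lattice_basis_ideal_def up_def down_def
  by (rule arg_cong[where f = "gen_ideal n"]) auto

lemma LI_polyring: "f \<in> LI \<Longrightarrow> f \<in> polyring n"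
  unfolding LI_eq
  by (erule subsetD[OF gen_ideal_subset_polyring, rotated]) auto

lemma LI_add: "f \<in> LI \<Longrightarrow> g \<in> LI \<Longrightarrow> f + g \<in> LI"
  by (simp add: LI_eq)

lemma LI_mult: "c \<in> polyring n \<Longrightarrow> f \<in> LI \<Longrightarrow> c * f \<in> LI"
  unfolding LI_eq by (rule gen_ideal_mult)

lemma LI_uminus: "f \<in> LI \<Longrightarrow> - f \<in> LI"
  unfolding LI_eq by (rule gen_ideal_uminus)

lemma edge_LI:
  assumes "edge u v" shows "monom u - monom v \<in> LI"
proof -
  obtain c w where c: "c < 2" "w \<in> exps n" "u = w + up c" "v = w + down c"
    using assms unfolding edge_def by blast
  have "monom w * (monom (up c) - monom (down c)) \<in> LI"
    unfolding LI_eq using c by (intro gen_ideal_scaled_gen) auto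
  then show ?thesis
    unfolding c by (simp add: monom_add right_diff_distrib)
qed

text \<open>Telescoping along the chain, with a sign for edges traversed backwards.\<close>

lemma equivclp_edge_LI:
  assumes "equivclp edge u v" shows "monom u - monom v \<in> LI"
  using assms
proof (induction rule: equivclp_induct)
  case base
  then show ?case by (simp add: LI_eq)
next
  case (step y z)
  have "monom y - monom z \<in> LI"
    using step.hyps(2) edge_LI[of y z] LI_uminus[OF edge_LI[of z y]] by auto
  from LI_add[OF step.IH this] show ?case by simp
qed

lemma sat_iff: "g \<in> sat \<longleftrightarrow> g \<in> polyring n \<and> (\<exists>l. monom (others_exp l) * g \<in> LI)"
  by (simp add: saturation_def prod_var_power)

lemma monom_others_exp_polyring [simp]: "monom (others_exp l) \<in> polyring n"
  by (intro polyring_monom othersD others_exp_others)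

lemma LI_subset_sat: "g \<in> LI \<Longrightarrow> g \<in> sat"
  unfolding sat_iff using LI_polyring LI_mult monom_others_exp_polyring by blast

lemma sat_add:
  assumes "f \<in> sat" "g \<in> sat" shows "f + g \<in> sat"
proof -
  obtain k l where "monom (others_exp k) * f \<in> LI" "monom (others_exp l) * g \<in> LI"
    using assms unfolding sat_iff by blast
  then have "monom (others_exp l) * (monom (others_exp k) * f) + monom (others_exp k) * (monom (others_exp l) * g) \<in> LI"
    using LI_add[OF LI_mult[OF monom_others_exp_polyring] LI_mult[OF monom_others_exp_polyring]] by blast
  then have "monom (others_exp (k + l)) * (f + g) \<in> LI"
    by (simp add: others_exp_add monom_add algebra_simps)
  then show ?thesis
    using assms unfolding sat_iff by (blast intro: polyring_add)
qed

lemma sat_mult: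
  assumes "c \<in> polyring n" "f \<in> sat" shows "c * f \<in> sat"
proof -
  obtain k where "monom (others_exp k) * f \<in> LI"
    using assms unfolding sat_iff by blast
  then have "c * (monom (others_exp k) * f) \<in> LI"
    using assms(1) by (rule LI_mult[rotated])
  then have "monom (others_exp k) * (c * f) \<in> LI"
    by (simp add: mult.left_commute)
  then show ?thesis
    using assms unfolding sat_iff by (blast intro: polyring_mult)
qed

lemma sat_zero: "0 \<in> sat"
  by (rule LI_subset_sat) (simp add: LI_eq)

lemma sat_sum: "(\<And>x. x \<in> A \<Longrightarrow> f x \<in> sat) \<Longrightarrow> sum f A \<in> sat"
proof (induction A rule: infinite_finite_induct)
  case (insert x A)
  then show ?case by (simp add: sat_add)
qed (simp_all add: sat_zero)

lemma eqv_sat: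
  assumes "eqv u v" "u \<in> exps n"
  shows "monom u - monom v \<in> sat"
proof -
  obtain w where w: "w \<in> others" "equivclp edge (u + w) (v + w)"
    using assms(1) unfolding eqv_def by blast
  \<comment> \<open>The total degree of \<open>w\<close> bounds each of its exponents, so
    \<open>w\<close> divides the \<open>l\<close>-th power of the product and the subtraction
    \<open>others_exp l - w\<close> is exact.\<close>
  define l where "l = (\<Sum>k<n. lookup w k)"
  have "lookup w k \<le> lookup (others_exp l) k" for k
  proof (cases "k \<in> {..<n} - {i, j}")
    case True
    then have "lookup w k \<le> l"
      unfolding l_def by (intro member_le_sum) auto
    then show ?thesis using True by (simp add: lookup_others_exp)
  next
    case False
    then have "lookup w k = 0"
      using othersD[OF w(1)] by (auto simp: exps_iff)
    then show ?thesis by simp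
  qed
  then have others_exp: "others_exp l = (others_exp l - w) + w"
    by (intro poly_mapping_eqI) (simp add: lookup_add lookup_minus)
  have "others_exp l \<in> exps n"
    by (intro othersD others_exp_others)
  then have "others_exp l - w \<in> exps n"
    using others_exp by (metis exps_add_iff)
  then have "monom (others_exp l - w) * (monom (u + w) - monom (v + w)) \<in> LI"
    by (intro LI_mult equivclp_edge_LI w polyring_monom)
  also have "monom (others_exp l - w) * (monom (u + w) - monom (v + w)) = monom (others_exp l) * (monom u - monom v)"
    by (subst (2) others_exp) (simp add: monom_add algebra_simps)
  finally show ?thesis
    using assms eqv_exps[OF assms(1)] unfolding sat_iff by (blast intro: polyring_diff polyring_monom)
qed

text \<open>A generator times a term joins two monomials of one class with opposite coefficients,
  which cancel in every class sum.\<close>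

lemma coeff_sum_LI:
  assumes "h \<in> LI" shows "coeff_sum (eqv a) h = 0"
  using assms unfolding LI_eq
proof (induction rule: gen_ideal_induct)
  case (scaled_gen f g)
  then obtain c where c: "c < 2" "g = monom (up c) - monom (down c)"
    by auto
  have split: "f * g = single (up c) 1 * f - single (down c) 1 * f"
    by (simp add: c monom_def algebra_simps)
  have "eqv a (up c + u) = eqv a (down c + u)" if "u \<in> keys f" for u
  proof -
    have "u \<in> exps n"
      using scaled_gen(1) that unfolding polyring_iff by blast
    then have "edge (u + up c) (u + down c)"
      unfolding edge_def using c(1) by blast
    from eqv_cong[OF edge_eqv[OF this]] show ?thesis
      by (simp add: add.commute)
  qed
  then have "coeff_sum (\<lambda>u. eqv a (up c + u)) f = coeff_sum (\<lambda>u. eqv a (down c + u)) f"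
    by (rule coeff_sum_cong)
  then show ?case
    by (simp add: split coeff_sum_diff coeff_sum_single_mult)
qed (simp_all add: coeff_sum_add)

text \<open>Translation by \<open>others_exp l\<close> preserves and reflects \<open>eqv\<close>, so
  the class sum of \<open>h\<close> is one of its multiple in \<open>LI\<close>.\<close>

lemma coeff_sum_sat:
  assumes "h \<in> sat" shows "coeff_sum (eqv a) h = 0"
proof -
  obtain l where "monom (others_exp l) * h \<in> LI"
    using assms unfolding sat_iff by blast
  then have "coeff_sum (eqv (others_exp l + a)) (single (others_exp l) 1 * h) = 0"
    unfolding monom_def by (rule coeff_sum_LI)
  then have "coeff_sum (\<lambda>u. eqv (others_exp l + a) (others_exp l + u)) h = 0"
    by (simp add: coeff_sum_single_mult)
  moreover have "eqv (others_exp l + a) (others_exp l + u) = eqv a u" for u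
    using eqv_add[of a u "others_exp l"] eqv_cancel[of a "others_exp l" u] others_exp_others[of l] othersD(1)
    by (auto simp: add.commute)
  ultimately show ?thesis by simp
qed

section \<open>Membership in the monomial ideals\<close>

lemma corner_multiple_iff:
  "(\<exists>v\<in>corners. \<exists>w. u = w + v) \<longleftrightarrow> p + q \<le> level u + 1"
proof
  assume "\<exists>v\<in>corners. \<exists>w. u = w + v"
  then obtain k w where k: "k \<le> p + q - 1"
    "u = w + (single i (k * d) + single j ((p + q - 1 - k) * e))"
    by (auto simp: corners_def corner_def)
  have "lookup u i = lookup w i + k * d" "lookup u j = lookup w j + (p + q - 1 - k) * e"
    using i_neq_j by (simp_all add: k lookup_add lookup_single when_def)
  then have "level u \<ge> k + (p + q - 1 - k)"
    using pos by (simp add: level_def)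
  then show "p + q \<le> level u + 1"
    using k(1) by simp
next
  assume level: "p + q \<le> level u + 1"
  \<comment> \<open>The divisor uses as much of \<open>x\<close> as \<open>u\<close> provides,
    capped at \<open>p + q - 1\<close>; the level then guarantees enough \<open>y\<close>.\<close>
  define k where "k = min (lookup u i div d) (p + q - 1)"
  define v where "v = single i (k * d) + single j ((p + q - 1 - k) * e)"
  have "k \<le> lookup u i div d"
    by (simp add: k_def)
  then have ki: "k * d \<le> lookup u i"
    using pos by (simp add: less_eq_div_iff_mult_less_eq)
  have "p + q - 1 - k \<le> lookup u j div e"
    using level unfolding k_def level_def by linarith
  then have kj: "(p + q - 1 - k) * e \<le> lookup u j"
    using pos by (simp add: less_eq_div_iff_mult_less_eq)
  have "u = (u - v) + v"
    by (rule poly_mapping_eqI)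
      (use ki kj i_neq_j in \<open>auto simp: lookup_add lookup_minus v_def lookup_single when_def\<close>)
  moreover have "v \<in> corners"
    unfolding corners_def v_def corner_def[symmetric] by (rule imageI) (simp add: k_def)
  ultimately show "\<exists>v\<in>corners. \<exists>w. u = w + v" by blast
qed

lemma corners_exps: "corners \<subseteq> exps n"
  using i_less j_less by (auto simp: corners_def corner_def)

lemma corner_ideal_iff:
  "f \<in> gen_ideal n (monom ` corners) \<longleftrightarrow> f \<in> polyring n \<and> (\<forall>u\<in>keys f. p + q \<le> level u + 1)"
  unfolding monomial_ideal_iff[OF corners_exps] corner_multiple_iff ..

lemma P_iff: "s \<in> P \<longleftrightarrow> s \<in> polyring n \<and> (\<forall>u\<in>keys s. u \<notin> others)"
proof -
  have "P = gen_ideal n (monom ` {single i 1, single j 1})"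
    by (simp add: var_def)
  moreover have "(\<exists>v\<in>{single i 1, single j 1}. \<exists>w. u = w + v) \<longleftrightarrow> u \<notin> others"
    if u: "u \<in> exps n" for u
  proof
    assume "\<exists>v\<in>{single i 1, single j 1}. \<exists>w. u = w + v"
    then show "u \<notin> others"
      by (auto simp: others_def lookup_add)
  next
    assume "u \<notin> others"
    then obtain k where k: "k \<in> {i, j}" "lookup u k > 0"
      using u by (auto simp: others_def)
    have "u = (u - single k 1) + single k 1"
      by (rule poly_mapping_eqI)
        (use k in \<open>auto simp: lookup_add lookup_minus lookup_single when_def\<close>)
    with k(1) show "\<exists>v\<in>{single i 1, single j 1}. \<exists>w. u = w + v" by blast
  qed
  moreover have "{single i 1, single j 1} \<subseteq> exps n"
    using i_less j_less by simp
  ultimately show ?thesis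
    using monomial_ideal_iff[of "{single i 1, single j 1}" n s] unfolding polyring_iff by blast
qed

lemma component_I: "f \<in> sat \<Longrightarrow> g \<in> gen_ideal n (monom ` corners) \<Longrightarrow> f + g \<in> component"
  unfolding ideal_sum_def by blast

lemma sat_subset_component: "f \<in> sat \<Longrightarrow> f \<in> component"
  using component_I[of f 0] by simp

text \<open>The level is constant on a class, and all terms of the monomial ideal have level at
  least \<open>p + q - 1\<close>. They miss a class of low level, so only the saturation
  contributes.\<close>

lemma coeff_sum_component:
  assumes "h \<in> component" "level a + 1 < p + q"
  shows "coeff_sum (eqv a) h = 0"
proof -
  obtain f g where h: "h = f + g" "f \<in> sat" "g \<in> gen_ideal n (monom ` corners)"
    using assms(1) unfolding ideal_sum_def by blast
  have "\<not> eqv a u" if "u \<in> keys g" for u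
  proof
    assume "eqv a u"
    then have "level a = level u" by (rule eqv_level)
    moreover have "p + q \<le> level u + 1"
      using h(3) that unfolding corner_ideal_iff by blast
    ultimately show False using assms(2) by simp
  qed
  then have "coeff_sum (eqv a) g = 0"
    by (rule coeff_sum_eq_0)
  then show ?thesis
    by (simp add: h(1) coeff_sum_add coeff_sum_sat[OF h(2)])
qed

text \<open>Equivalent monomials agree modulo the saturation, so every term may be moved to a chosen
  member of its class.\<close>

lemma representatives:
  assumes "f \<in> polyring n"
  obtains f' where "f' \<in> polyring n" "f - f' \<in> sat"
    "\<And>u v. u \<in> keys f' \<Longrightarrow> v \<in> keys f' \<Longrightarrow> eqv u v \<Longrightarrow> u = v"
proof
  define rep where "rep u = (SOME v. eqv u v)" for u
  have rep: "eqv u (rep u)" for u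
    unfolding rep_def by (rule someI) (rule eqv_refl)
  \<comment> \<open>The choice sees only the predicate \<open>eqv u\<close>, which is the same for
    all members of a class.\<close>
  have rep_cong: "rep u = rep v" if "eqv u v" for u v
  proof -
    have "eqv u = eqv v"
      using eqv_trans[OF that] eqv_trans[OF eqv_sym[OF that]] by blast
    then show ?thesis by (simp add: rep_def)
  qed
  define f' where "f' = (\<Sum>u\<in>keys f. single (rep u) (lookup f u))"
  have exps: "u \<in> exps n" if "u \<in> keys f" for u
    using assms that unfolding polyring_iff by blast
  show "f' \<in> polyring n"
    unfolding f'_def using exps eqv_exps[OF rep] by (intro polyring_sum polyring_single) blast
  have "f - f' = (\<Sum>u\<in>keys f. single u (lookup f u)) - f'"
    by (simp only: poly_eq_sum_singles)
  also have "\<dots> = (\<Sum>u\<in>keys f. single 0 (lookup f u) * (monom u - monom (rep u)))"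
    by (simp add: f'_def sum_subtractf monom_def right_diff_distrib mult_single)
  also have "\<dots> \<in> sat"
    by (intro sat_sum sat_mult polyring_single eqv_sat rep exps exps_zero)
  finally show "f - f' \<in> sat" .
  have "keys f' \<subseteq> (\<Union>u\<in>keys f. keys (single (rep u) (lookup f u)))"
    unfolding f'_def by (rule Poly_Mapping.keys_sum)
  then have keys: "keys f' \<subseteq> rep ` keys f"
    by auto
  show "u = v" if uv: "u \<in> keys f'" "v \<in> keys f'" "eqv u v" for u v
  proof -
    obtain x y where "u = rep x" "v = rep y"
      using uv(1,2) keys by blast
    then have "eqv x y"
      using uv(3) rep[of x] rep[of y] eqv_trans eqv_sym by blast
    then show ?thesis
      using rep_cong \<open>u = rep x\<close> \<open>v = rep y\<close> by simp
  qed
qed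

lemma component_add: "f \<in> component \<Longrightarrow> g \<in> component \<Longrightarrow> f + g \<in> component"
proof -
  assume "f \<in> component" "g \<in> component"
  then obtain a b c d where "f = a + b" "a \<in> sat" "b \<in> gen_ideal n (monom ` corners)"
    "g = c + d" "c \<in> sat" "d \<in> gen_ideal n (monom ` corners)"
    unfolding ideal_sum_def by blast
  then show "f + g \<in> component"
    using component_I[of "a + c" "b + d"] by (simp add: sat_add ac_simps)
qed

text \<open>
  Replace \<open>f\<close> by a combination of class representatives. If one of them has low level, take the
  terms of \<open>f\<close> of least weight among those, and the one maximising \<open>shifted\<close> there. Its product with the
  largest term of \<open>s\<close> free of \<open>x\<^sub>i, x\<^sub>j\<close> is alone in its class in \<open>s f\<close> and cannot cancel.
\<close>

lemma component_primary:
  assumes s: "s \<in> polyring n" "s \<notin> P" and f: "f \<in> polyring n" and sf: "s * f \<in> component"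
  shows "f \<in> component"
proof -
  obtain f' where f': "f' \<in> polyring n" "f - f' \<in> sat"
    and inj: "\<And>u v. u \<in> keys f' \<Longrightarrow> v \<in> keys f' \<Longrightarrow> eqv u v \<Longrightarrow> u = v"
    using representatives[OF f] by blast
  have "p + q \<le> level u + 1" if u: "u \<in> keys f'" for u
  proof (rule ccontr)
    let ?W = "keys s \<inter> others" and ?U = "{u \<in> keys f'. level u + 1 < p + q}"
    assume "\<not> p + q \<le> level u + 1"
    then have "?U \<noteq> {}"
      using u by auto
    then obtain y where y: "y \<in> ?U" "\<And>u. u \<in> ?U \<Longrightarrow> - int (weight u) \<le> - int (weight y)"
      using finite_obtains_max[of ?U "\<lambda>u. - int (weight u)"] by auto
    let ?V = "{u \<in> ?U. weight u = weight y}"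
    obtain u where u: "u \<in> ?V" "\<And>v. v \<in> ?V \<Longrightarrow> shifted v \<le> shifted u"
      using finite_obtains_max[of ?V shifted] y(1) by auto
    have "?W \<noteq> {}"
      using s by (auto simp: P_iff)
    then obtain w where w: "w \<in> ?W" "\<And>v. v \<in> ?W \<Longrightarrow> int_exp v \<le> int_exp w"
      using finite_obtains_max[of ?W int_exp] by auto
    have w_others: "w \<in> others"
      using w(1) by simp
    have unique: "w' = w \<and> u' = u" if w': "w' \<in> keys s" and u': "u' \<in> keys f'"
      and eqv: "eqv (w + u) (w' + u')" for w' u'
    proof -
      have w'_exps: "w' \<in> exps n"
        using s(1) w' unfolding polyring_iff by blast
      have level_w: "level (w + u) = level u"
        using level_add[OF w_others, of u] by (simp add: add.commute)
      \<comment> \<open>Multiplication cannot lower the level, so \<open>u'\<close> is a low-level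
        term as well, and minimality of the weight of \<open>u\<close> then forces \<open>w'\<close>
        to have weight zero.\<close>
      have "level u' \<le> level (w' + u')"
        unfolding level_def lookup_add by (intro add_mono div_le_mono) simp_all
      then have "u' \<in> ?U"
        using u(1) u' eqv_level[OF eqv] level_w by simp
      then have "weight u \<le> weight u'"
        using y(2)[of u'] u(1) by simp
      moreover have "weight w = 0"
        using w_others others_iff_weight othersD(1) by blast
      then have "weight u = weight w' + weight u'"
        using eqv_weight[OF eqv] by (simp add: weight_add)
      ultimately have weights: "weight w' = 0" "weight u' = weight u"
        by simp_all
      have w'_others: "w' \<in> others"
        using weights(1) others_iff_weight w'_exps by blast
      have "shifted (w + u) = shifted (w' + u')"
        using eqv_shifted[OF eqv] level_w u(1) by simp
      then have sums: "shifted u + int_exp w = shifted u' + int_exp w'"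
        using shifted_add[OF w_others, of u] shifted_add[OF w'_others, of u'] by (simp add: add.commute)
      have "shifted u' \<le> shifted u"
        using u(2)[of u'] \<open>u' \<in> ?U\<close> weights(2) u(1) by simp
      moreover have "int_exp w' \<le> int_exp w"
        using w(2)[of w'] w' w'_others by simp
      \<comment> \<open>Both summands on the left are maximal and the order is compatible with
        addition, so equal sums force equal summands.\<close>
      ultimately have "int_exp w' = int_exp w"
        using sums by (metis add_le_cancel_left add_right_mono antisym)
      then have "w' = w" by simp
      with eqv have "eqv (u + w) (u' + w)"
        by (simp add: add.commute)
      then have "eqv u u'"
        using w_others by (rule eqv_cancel)
      then show ?thesis
        using \<open>w' = w\<close> inj[of u u'] u(1) u' by simp
    qed
    have "coeff_sum (eqv (w + u)) (s * f') =
      (\<Sum>w'\<in>keys s. \<Sum>u'\<in>keys f'. lookup s w' * lookup f' u' when w' = w \<and> u' = u)"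
      unfolding coeff_sum_mult by (intro sum.cong refl when_cong) (auto dest: unique)
    also have "\<dots> = (\<Sum>w'\<in>keys s. lookup s w' * lookup f' u when w' = w)"
    proof (rule sum.cong[OF refl])
      fix w' 
      have "(\<Sum>u'\<in>keys f'. lookup s w' * lookup f' u' when w' = w \<and> u' = u)
        = (\<Sum>u'\<in>keys f'. if u' = u then (lookup s w' * lookup f' u when w' = w) else 0)"
        by (intro sum.cong) (auto simp: when_def)
      then show "(\<Sum>u'\<in>keys f'. lookup s w' * lookup f' u' when w' = w \<and> u' = u)
        = (lookup s w' * lookup f' u when w' = w)"
        using u(1) by simp
    qed
    also have "\<dots> = lookup s w * lookup f' u"
      using w(1) by (simp add: when_def)
    finally have "coeff_sum (eqv (w + u)) (s * f') \<noteq> 0"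
      using w(1) u(1) by (simp add: in_keys_iff)
    \<comment> \<open>Passing from \<open>f\<close> to \<open>f'\<close> changes the product only by
      an element of the saturation.\<close>
    moreover have "s * f' = s * f + (- s) * (f - f')"
      by (simp add: algebra_simps)
    moreover have "s * f + (- s) * (f - f') \<in> component"
      using s(1) f'(2) by (intro component_add sf sat_subset_component sat_mult polyring_uminus)
    moreover have "level (w + u) + 1 < p + q"
      using level_add[OF w_others, of u] u(1) by (simp add: add.commute)
    ultimately show False
      using coeff_sum_component by metis
  qed
  then have "f' \<in> gen_ideal n (monom ` corners)"
    using f'(1) by (simp add: corner_ideal_iff)
  from component_I[OF f'(2) this] show ?thesis by simp
qed

text \<open>The monomial has sum \<open>1\<close> over its own class, whereas on
  \<open>component\<close> the sums over classes of low level vanish.\<close>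

lemma monom_in_component:
  assumes "monom u \<in> (component :: 'k::field mpoly set)" "u \<in> exps n"
  shows "monom u \<in> (gen_ideal n (monom ` corners) :: 'k mpoly set)"
proof -
  have "coeff_sum (eqv u) (monom u :: 'k mpoly) = 1"
    by (simp add: monom_def)
  then have "p + q \<le> level u + 1"
    using coeff_sum_component[OF assms(1), of u] by (cases "level u + 1 < p + q") auto
  then show ?thesis
    using assms(2) unfolding corner_ideal_iff by (simp add: polyring_iff monom_def)
qed

section \<open>Primality of the ideal of \<open>x_i\<close> and \<open>x_j\<close>\<close>

lemma decompose_mod_P:
  assumes "f \<in> polyring n"
  obtains g h where "f = g + h" "keys g \<subseteq> others" "g \<in> polyring n" "h \<in> P"
proof
  let ?g = "\<Sum>u\<in>keys f \<inter> others. single u (lookup f u)"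
  let ?h = "\<Sum>u\<in>keys f - others. single u (lookup f u)"
  have exps: "u \<in> exps n" if "u \<in> keys f" for u
    using assms that unfolding polyring_iff by blast
  have "f = (\<Sum>u\<in>keys f. single u (lookup f u))"
    by (simp only: poly_eq_sum_singles)
  also have "keys f = (keys f \<inter> others) \<union> (keys f - others)"
    by blast
  also have "(\<Sum>u\<in>(keys f \<inter> others) \<union> (keys f - others). single u (lookup f u)) = ?g + ?h"
    by (intro sum.union_disjoint) auto
  finally show "f = ?g + ?h" .
  have "keys ?g \<subseteq> (\<Union>u\<in>keys f \<inter> others. keys (single u (lookup f u)))"
    by (rule Poly_Mapping.keys_sum)
  then show "keys ?g \<subseteq> others"
    by auto
  show "?g \<in> polyring n"
    using exps by (intro polyring_sum polyring_single) auto
  show "?h \<in> P"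
    using exps by (intro gen_ideal_sum) (auto simp: P_iff)
qed

text \<open>Modulo \<open>P\<close> a polynomial is its part free of \<open>x_i\<close> and
  \<open>x_j\<close>; products of such parts are again free of them, and the polynomials have no
  zero divisors.\<close>

lemma P_prime:
  assumes "s \<in> polyring n" "t \<in> polyring n" "s \<notin> P" "t \<notin> P"
  shows "s * t \<notin> P"
proof
  assume st: "s * t \<in> P"
  obtain s0 s1 where s: "s = s0 + s1" "keys s0 \<subseteq> others" "s0 \<in> polyring n" "s1 \<in> P"
    using decompose_mod_P[OF assms(1)] by blast
  obtain t0 t1 where t: "t = t0 + t1" "keys t0 \<subseteq> others" "t0 \<in> polyring n" "t1 \<in> P"
    using decompose_mod_P[OF assms(2)] by blast
  have "s0 * t0 = s * t + (- (s0 * t1) + - (t * s1))"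
    by (simp add: s(1) t(1) algebra_simps)
  also have "\<dots> \<in> P"
    by (intro gen_ideal_add st gen_ideal_uminus gen_ideal_mult[OF s(3) t(4)]
        gen_ideal_mult[OF assms(2) s(4)])
  finally have "\<forall>u\<in>keys (s0 * t0). u \<notin> others"
    by (simp add: P_iff)
  moreover have "keys (s0 * t0) \<subseteq> others"
    using Poly_Mapping.keys_mult[of s0 t0] s(2) t(2) by fastforce
  ultimately have "s0 * t0 = 0"
    by (metis (no_types) Poly_Mapping.keys_eq_empty subset_empty subsetD subsetI)
  then have "s0 = 0 \<or> t0 = 0"
    by simp
  then show False
    using s t assms by auto
qed

section \<open>The cycle of corners\<close>

text \<open>Applied to \<open>up 0\<close>, \<open>down 0\<close>, \<open>up 1\<close>,
  \<open>down 1\<close> this yields the monomials \<open>m_1\<close>, \<open>m_2\<close>,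
  \<open>m_3\<close>, \<open>m_4\<close> of the generators.\<close>

definition strip :: "(nat \<Rightarrow>\<^sub>0 nat) \<Rightarrow> (nat \<Rightarrow>\<^sub>0 nat)" where
  "strip u = u - (single i (lookup u i) + single j (lookup u j))"

lemma lookup_strip: "lookup (strip u) r = (if r = i \<or> r = j then 0 else lookup u r)"
  using i_neq_j by (auto simp: strip_def lookup_minus lookup_add lookup_single when_def)

lemma strip_others: "u \<in> exps n \<Longrightarrow> strip u \<in> others"
  by (simp add: others_def exps_iff lookup_strip)

text \<open>This is the first generator times \<open>x^c y^(q - 1 - c)\<close>, a monomial because
  \<open>c < q\<close>.\<close>

lemma edge_corner_p:
  assumes "c < q"
  shows "edge (strip (up 0) + corner (c + p)) (strip (down 0) + corner c)"
proof -
  let ?w = "single i (c * d) + single j ((q - 1 - c) * e)"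
  have c: "p + q - 1 - (c + p) = q - 1 - c" "p + q - 1 - c = (q - 1 - c) + p"
    using assms by simp_all
  have "strip (up 0) + corner (c + p) = ?w + up 0"
    by (rule poly_mapping_eqI)
      (use i_neq_j c(1) in \<open>auto simp: lookup_add lookup_strip corner_def lookup_single when_def
        lookup_up_down_ij step_def algebra_simps\<close>)
  moreover have "strip (down 0) + corner c = ?w + down 0"
    unfolding corner_def c(2)
    by (rule poly_mapping_eqI)
      (use i_neq_j in \<open>auto simp: lookup_add lookup_strip lookup_single when_def
        lookup_up_down_ij step_def algebra_simps\<close>)
  moreover have "?w \<in> exps n"
    using i_less j_less by simp
  ultimately show ?thesis
    unfolding edge_def by (intro exI[of _ 0] conjI bexI[of _ ?w]) auto
qed

lemma edge_corner_q:
  assumes "c < p"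
  shows "edge (strip (up 1) + corner (c + q)) (strip (down 1) + corner c)"
proof -
  let ?w = "single i (c * d) + single j ((p - 1 - c) * e)"
  have c: "p + q - 1 - (c + q) = p - 1 - c" "p + q - 1 - c = (p - 1 - c) + q"
    using assms by simp_all
  have "strip (up 1) + corner (c + q) = ?w + up 1"
    by (rule poly_mapping_eqI)
      (use i_neq_j c(1) in \<open>auto simp: lookup_add lookup_strip corner_def lookup_single when_def
        lookup_up_down_ij step_def algebra_simps\<close>)
  moreover have "strip (down 1) + corner c = ?w + down 1"
    unfolding corner_def c(2)
    by (rule poly_mapping_eqI)
      (use i_neq_j in \<open>auto simp: lookup_add lookup_strip lookup_single when_def
        lookup_up_down_ij step_def algebra_simps\<close>)
  moreover have "?w \<in> exps n"
    using i_less j_less by simp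
  ultimately show ?thesis
    unfolding edge_def by (intro exI[of _ 1] conjI bexI[of _ ?w]) auto
qed

lemma lookup_strip_up_down:
  assumes "r \<in> {..<n} - {i, j}"
  shows "int (lookup (strip (up c)) r) - int (lookup (strip (down c)) r) = b r c"
  using assms lookup_up_down[of r c] by (simp add: lookup_strip)

text \<open>The chain is multiplied by \<open>D\<close> and the edge by \<open>B\<close>, so that
  they meet at \<open>B + D + y\<close>.\<close>

lemma equivclp_edge_snoc:
  assumes "equivclp edge (A + x) (B + y)" "edge (D + y) (C + z) \<or> edge (C + z) (D + y)"
    and "B \<in> exps n" "D \<in> exps n"
  shows "equivclp edge (A + D + x) (B + C + z)"
proof -
  have "equivclp edge (A + x + D) (B + y + D)"
    using assms(1,4) by (rule equivclp_edge_add)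
  moreover have "edge (D + y + B) (C + z + B) \<or> edge (C + z + B) (D + y + B)"
    using assms(2,3) edge_add by blast
  ultimately show ?thesis
    using equivclp_into_equivclp[of edge "A + x + D" "B + y + D" "C + z + B"] by (simp add: ac_simps)
qed

text \<open>
  After \<open>x\<close> moves by \<open>p\<close> and \<open>y\<close> moves by \<open>- q\<close> the corner \<open>c\<close> has become \<open>c'\<close>, and \<open>B - A\<close> is the
  Laurent monomial picked up on the way.
\<close>

definition walk ::
  "nat \<Rightarrow> nat \<Rightarrow> (nat \<Rightarrow>\<^sub>0 nat) \<Rightarrow> (nat \<Rightarrow>\<^sub>0 nat) \<Rightarrow> nat \<Rightarrow> nat \<Rightarrow> nat \<Rightarrow> bool" where
  "walk c k A B c' x y \<longleftrightarrow> A \<in> others \<and> B \<in> others \<and> c' < p + q \<and> x + y = k \<and>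
    equivclp edge (A + corner c) (B + corner c') \<and>
    int c' = int c + int x * int p - int y * int q \<and>
    (\<forall>r\<in>{..<n} - {i, j}. int (lookup B r) - int (lookup A r) = int x * b r 0 - int y * b r 1)"

lemma walkD:
  assumes "walk c k A B c' x y"
  shows "A \<in> others" "B \<in> others" "c' < p + q" "x + y = k"
    "equivclp edge (A + corner c) (B + corner c')"
    "int c' = int c + int x * int p - int y * int q"
    "\<And>r. r \<in> {..<n} - {i, j} \<Longrightarrow> int (lookup B r) - int (lookup A r) = int x * b r 0 - int y * b r 1"
  using assms unfolding walk_def by simp_all

text \<open>No corner is a dead end: \<open>c' < q\<close> allows the move to \<open>c' + p\<close>,
  and \<open>c' \<ge> q\<close> the move to \<open>c' - q\<close>; both stay below
  \<open>p + q\<close>.\<close>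

lemma walk_exists:
  assumes "c < p + q"
  shows "\<exists>A B c' x y. walk c k A B c' x y"
proof (induction k)
  case 0
  have "walk c 0 0 0 c 0 0"
    using assms by (simp add: walk_def)
  then show ?case by blast
next
  case (Suc k)
  then obtain A B c' x y where "walk c k A B c' x y"
    by blast
  note IH = walkD[OF this]
  have strip_o: "strip (up c) \<in> others" "strip (down c) \<in> others" for c
    by (simp_all add: strip_others)
  show ?case
  proof (cases "c' < q")
    case True
    let ?A = "A + strip (down 0)" and ?B = "B + strip (up 0)"
    have "equivclp edge (?A + corner c) (?B + corner (c' + p))"
      using IH(2,5) edge_corner_p[OF True] strip_o othersD(1) by (intro equivclp_edge_snoc) blast+
    moreover have "int (c' + p) = int c + int (Suc x) * int p - int y * int q"
      using IH(6) by (simp add: algebra_simps)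
    moreover have "int (lookup ?B r) - int (lookup ?A r) = int (Suc x) * b r 0 - int y * b r 1"
      if "r \<in> {..<n} - {i, j}" for r
      using IH(7)[OF that] lookup_strip_up_down[OF that, of 0] by (simp add: lookup_add algebra_simps)
    moreover have "?A \<in> others" "?B \<in> others"
      using IH(1,2) strip_o by simp_all
    moreover have "c' + p < p + q" "Suc x + y = Suc k"
      using True IH(4) by simp_all
    ultimately have "walk c (Suc k) ?A ?B (c' + p) (Suc x) y"
      unfolding walk_def by (intro conjI ballI)
    then show ?thesis by blast
  next
    case False
    \<comment> \<open>This move runs from \<open>up 1\<close> to \<open>down 1\<close>, opposite to
      the direction of the previous case, so \<open>strip (up 1)\<close> joins the starting
      side.\<close>
    let ?A = "A + strip (up 1)" and ?B = "B + strip (down 1)"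
    have "c' - q < p" "c' - q + q = c'"
      using False IH(3) by simp_all
    then have "edge (strip (up 1) + corner c') (strip (down 1) + corner (c' - q))"
      using edge_corner_q[of "c' - q"] by simp
    then have "equivclp edge (?A + corner c) (?B + corner (c' - q))"
      using IH(2,5) strip_o othersD(1) by (intro equivclp_edge_snoc) blast+
    moreover have "int (c' - q) = int c + int x * int p - int (Suc y) * int q"
      using IH(6) False by (simp add: algebra_simps of_nat_diff)
    moreover have "int (lookup ?B r) - int (lookup ?A r) = int x * b r 0 - int (Suc y) * b r 1"
      if "r \<in> {..<n} - {i, j}" for r
      using IH(7)[OF that] lookup_strip_up_down[OF that, of 1] by (simp add: lookup_add algebra_simps)
    moreover have "?A \<in> others" "?B \<in> others"
      using IH(1,2) strip_o by simp_all
    moreover have "c' - q < p + q" "x + Suc y = Suc k"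
      using IH(3,4) by simp_all
    ultimately have "walk c (Suc k) ?A ?B (c' - q) x (Suc y)"
      unfolding walk_def by (intro conjI ballI)
    then show ?thesis by blast
  qed
qed

text \<open>Rows \<open>i\<close> and \<open>j\<close> are multiples of \<open>(p, q)\<close>, so
  the combination of the columns with coefficients \<open>q\<close> and \<open>- p\<close> vanishes
  there; by rank two it is nonzero in some other row.\<close>

lemma rank_witness:
  obtains r where "r \<in> {..<n} - {i, j}" "int q * b r 0 \<noteq> int p * b r 1"
proof -
  have "\<not> (\<forall>r<n. of_nat q * of_int (b r 0) + (- of_nat p) * of_int (b r 1) = (0::rat))"
  proof
    assume "\<forall>r<n. of_nat q * of_int (b r 0) + (- of_nat p) * of_int (b r 1) = (0::rat)"
    then have "(of_nat q :: rat) = 0 \<and> - of_nat p = (0::rat)"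
      by (rule rank[unfolded rank2_def, THEN spec, THEN spec, THEN mp])
    then show False using pos by simp
  qed
  then obtain r where r: "r < n" "of_nat q * of_int (b r 0) + (- of_nat p) * of_int (b r 1) \<noteq> (0::rat)"
    by blast
  have "int q * b r 0 \<noteq> int p * b r 1"
  proof
    assume "int q * b r 0 = int p * b r 1"
    then have "(of_int (int q * b r 0) :: rat) = of_int (int p * b r 1)"
      by (rule arg_cong)
    then show False using r(2) by simp
  qed
  moreover from this have "r \<noteq> i" "r \<noteq> j"
    using row_i row_j by auto
  ultimately show ?thesis
    using that r(1) by simp
qed

text \<open>After \<open>p + q\<close> moves the walk is back at \<open>c\<close>, and the monomials
  \<open>A\<close> and \<open>B\<close> collected on the two sides differ; their binomial
  annihilates the corner modulo \<open>LI\<close>.\<close>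

lemma corner_annihilator:
  assumes "c < p + q"
  obtains s where "s \<in> polyring n" "s \<notin> (P :: 'k::field mpoly set)" "s * monom (corner c) \<in> LI"
proof -
  obtain A B c' x y where "walk c (p + q) A B c' x y"
    using walk_exists[OF assms] by blast
  note * = walkD[OF this]
  \<comment> \<open>The excess over \<open>q\<close> moves upwards. The total displacement is
    \<open>(p + q) t\<close> but smaller than \<open>p + q\<close> in absolute value, which forces
    \<open>t = 0\<close>.\<close>
  define t where "t = int x - int q"
  have xy: "int x = int q + t" "int y = int p - t"
    using *(4) unfolding t_def by linarith+
  have "int c' - int c = (int p + int q) * t"
    using *(6) unfolding xy by (simp add: algebra_simps)
  moreover have "\<bar>int c' - int c\<bar> < int p + int q"
    using *(3) assms by linarith
  ultimately have "(int p + int q) * \<bar>t\<bar> < (int p + int q) * 1"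
    by (simp add: abs_mult)
  then have t: "t = 0"
    using pos by (simp only: mult_less_cancel_left_pos add_pos_pos of_nat_0_less_iff)
  then have "c' = c"
    using \<open>int c' - int c = (int p + int q) * t\<close> by simp
  obtain r where r: "r \<in> {..<n} - {i, j}" "int q * b r 0 \<noteq> int p * b r 1"
    by (rule rank_witness)
  \<comment> \<open>With \<open>t = 0\<close> the exponents differ at \<open>r\<close> by
    \<open>q * b r 0 - p * b r 1\<close>, nonzero by the choice of \<open>r\<close>.\<close>
  have "A \<noteq> B"
    using *(7)[OF r(1)] r(2) unfolding xy t by auto
  let ?s = "monom A - monom B :: 'k mpoly"
  show ?thesis
  proof
    show "?s \<in> polyring n"
      using *(1,2) othersD(1) by (intro polyring_diff polyring_monom) blast+
    have "lookup ?s A \<noteq> 0"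
      using \<open>A \<noteq> B\<close> by (simp add: lookup_minus monom_def lookup_single when_def)
    then have "A \<in> keys ?s"
      by (simp add: in_keys_iff)
    then show "?s \<notin> P"
      using *(1) by (auto simp: P_iff)
    show "?s * monom (corner c) \<in> LI"
      using equivclp_edge_LI[OF *(5)] unfolding \<open>c' = c\<close> by (simp add: monom_add left_diff_distrib)
  qed
qed

section \<open>The primary component\<close>

abbreviation primary :: "'k::field mpoly set" where
  "primary \<equiv> primary_component n LI P"

text \<open>Denominators are multiplied, and primality keeps the product outside
  \<open>P\<close>.\<close>

lemma primary_add:
  assumes "f \<in> primary" "g \<in> primary" shows "f + g \<in> primary"
proof -
  obtain s t where s: "s \<in> polyring n" "s \<notin> P" "s * f \<in> LI"
    and t: "t \<in> polyring n" "t \<notin> P" "t * g \<in> LI"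
    and fg: "f \<in> polyring n" "g \<in> polyring n"
    using assms unfolding primary_component_def by blast
  have "(s * t) * (f + g) = t * (s * f) + s * (t * g)"
    by (simp add: algebra_simps)
  also have "\<dots> \<in> LI"
    by (rule LI_add[OF LI_mult[OF t(1) s(3)] LI_mult[OF s(1) t(3)]])
  finally have "(s * t) * (f + g) \<in> LI" .
  moreover have "s * t \<in> polyring n" "s * t \<notin> P"
    using s t P_prime by (blast intro: polyring_mult)+
  ultimately show ?thesis
    unfolding primary_component_def using polyring_add[OF fg] by blast
qed

lemma primary_mult:
  assumes "c \<in> polyring n" "f \<in> primary" shows "c * f \<in> primary"
proof -
  obtain s where s: "s \<in> polyring n" "s \<notin> P" "s * f \<in> LI" and f: "f \<in> polyring n"
    using assms(2) unfolding primary_component_def by blast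
  have "s * (c * f) \<in> LI"
    using LI_mult[OF assms(1) s(3)] by (simp add: mult.left_commute)
  then show ?thesis
    unfolding primary_component_def using s polyring_mult[OF assms(1) f] by blast
qed

text \<open>Powers of the product of the other variables lie outside \<open>P\<close> and are
  admissible denominators.\<close>

lemma sat_subset_primary: "f \<in> sat \<Longrightarrow> f \<in> primary"
proof -
  assume "f \<in> sat"
  then obtain l where l: "f \<in> polyring n" "monom (others_exp l) * f \<in> LI"
    unfolding sat_iff by blast
  have "monom (others_exp l) \<notin> P"
    using others_exp_others[of l] by (simp add: P_iff monom_def)
  then show "f \<in> primary"
    unfolding primary_component_def using l monom_others_exp_polyring by blast
qed

lemma monom_corner_primary:
  assumes "v \<in> corners" shows "monom v \<in> (primary :: 'k::field mpoly set)"
proof -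
  obtain c where c: "v = corner c" "c < p + q"
    using assms pos by (auto simp: corners_def)
  obtain s :: "'k mpoly" where "s \<in> polyring n" "s \<notin> P" "s * monom v \<in> LI"
    using corner_annihilator[OF c(2)] unfolding c(1) by blast
  moreover have "monom v \<in> (polyring n :: 'k mpoly set)"
    using assms corners_exps by (intro polyring_monom) blast
  ultimately show ?thesis
    unfolding primary_component_def by blast
qed

lemma corner_ideal_subset_primary:
  assumes "f \<in> gen_ideal n (monom ` corners)" shows "f \<in> primary"
  using assms
proof (induction rule: gen_ideal_induct)
  case zero
  show ?case by (rule sat_subset_primary[OF sat_zero])
next
  case (scaled_gen c g)
  then show ?case using primary_mult monom_corner_primary by blast
qed (rule primary_add)

text \<open>Forwards, \<open>component\<close> contains \<open>LI\<close> and factors outside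
  \<open>P\<close> can be cancelled in it by \<open>component_primary\<close>. Backwards, elements
  of both summands are multiplied into \<open>LI\<close> by elements outside
  \<open>P\<close>.\<close>

lemma primary_eq_component: "primary = component"
proof
  show "primary \<subseteq> component"
    unfolding primary_component_def using component_primary sat_subset_component LI_subset_sat by blast
  show "component \<subseteq> primary"
    unfolding ideal_sum_def using primary_add sat_subset_primary corner_ideal_subset_primary by blast
qed

end

section \<open>Reduction of the hypotheses to coprime form\<close>

lemma opposite_rows_exist:
  fixes b :: "nat \<Rightarrow> nat \<Rightarrow> int"
  assumes "rank2 n b" "i < n" "j < n" "i \<noteq> j"
    and cross: "b i 0 * b j 1 = b i 1 * b j 0"
    and sign: "b i 0 > 0" "b i 1 > 0" "b j 0 < 0" "b j 1 < 0"
  obtains d e p q where "opposite_rows n i j b d e p q" "int d = gcd (b i 0) (b i 1)"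
proof -
  define g where "g = gcd (b i 0) (b i 1)"
  have g: "g > 0"
    using sign by (simp add: g_def)
  obtain p' q' where pq': "b i 0 = g * p'" "b i 1 = g * q'" "coprime p' q'"
    using gcd_coprime_exists[of "b i 0" "b i 1"] sign by (auto simp: g_def mult.commute)
  have p': "p' > 0" and q': "q' > 0"
    using sign g unfolding pq' by (simp_all add: zero_less_mult_iff)
  \<comment> \<open>Coprimality turns this proportionality into row \<open>j\<close> being
    \<open>t\<close> times \<open>(p', q')\<close>; then \<open>- t\<close> becomes
    \<open>e\<close>.\<close>
  have cross': "p' * b j 1 = q' * b j 0"
    using cross g unfolding pq' by simp
  then have "p' dvd q' * b j 0"
    by (metis dvd_triv_left)
  then have "p' dvd b j 0"
    using pq'(3) by (simp add: coprime_dvd_mult_right_iff)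
  then obtain t where t: "b j 0 = p' * t" ..
  have t': "b j 1 = q' * t"
    using cross' p' unfolding t by simp
  have "t < 0"
    using sign(3) p' unfolding t by (simp add: mult_less_0_iff)
  show ?thesis
  proof
    show "opposite_rows n i j b (nat g) (nat (- t)) (nat p') (nat q')"
      using assms(1-4) g p' q' \<open>t < 0\<close> pq' t t'
      by unfold_locales (simp_all add: coprime_int_iff[symmetric])
    show "int (nat g) = gcd (b i 0) (b i 1)"
      using g by (simp add: g_def)
  qed
qed

theorem theorem5p1:
  fixes n i j :: nat and b :: "nat \<Rightarrow> nat \<Rightarrow> int" and d :: int and lam :: rat
  assumes "alg_closed TYPE('k::field_char_0)"
    and "rank2 n b"
    and "i < n" and "j < n" and "i \<noteq> j"
    and "b i 0 * b j 1 = b i 1 * b j 0"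
    and "b i 0 > 0" and "b i 1 > 0" and "b j 0 < 0" and "b j 1 < 0"
    and "d = gcd (b i 0) (b i 1)"
    and "lam = - of_int (b j 0) / of_int (b i 0)"
  defines "M \<equiv> {monom (Poly_Mapping.single i (nat (int k * d)) + Poly_Mapping.single j (nat \<lfloor>lam * of_int (b i 0 + b i 1 - (int k + 1) * d)\<rfloor>)) | k.
               int k \<le> (b i 0 + b i 1 - d) div d}"
    and "I \<equiv> (lattice_basis_ideal n b :: 'k mpoly set)"
    and "P \<equiv> gen_ideal n {var i, var j}"
  shows "(primary_component n I P
           = ideal_sum (saturation n I (\<Prod>k \<in> {..<n} - {i, j}. var k)) (gen_ideal n M))
         \<and> (\<forall>u. (\<forall>v \<in> Poly_Mapping.keys u. v < n) \<longrightarrow> monom u \<in> primary_component n I P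
           \<longrightarrow> monom u \<in> gen_ideal n M)"
proof -
  \<comment> \<open>The natural number \<open>g\<close> takes the place of the integer
    \<open>d\<close> of the theorem as the first parameter of the locale.\<close>
  obtain g e p q where opp: "opposite_rows n i j b g e p q" and g: "int g = d"
    using opposite_rows_exist[of n b i j] assms by metis
  interpret opposite_rows n i j b g e p q
    by (rule opp)
  have sum: "b i 0 + b i 1 = d * (int p + int q)"
    unfolding row_i g[symmetric] by (simp add: algebra_simps)
  have "(b i 0 + b i 1 - d) div d = int p + int q - 1"
  proof -
    have "b i 0 + b i 1 - d = d * (int p + int q - 1)"
      unfolding sum by (simp add: algebra_simps)
    then show ?thesis using pos g by simp
  qed
  then have bound: "int k \<le> (b i 0 + b i 1 - d) div d \<longleftrightarrow> k \<in> {..p + q - 1}" for k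
    using pos by auto
  \<comment> \<open>The exponents of \<open>x_j\<close> are \<open>lam\<close> times multiples of
    \<open>d\<close>, hence integers, and the floor in \<open>M\<close> rounds nothing.\<close>
  have "lam * of_int d = of_nat e"
    using pos unfolding assms(12) row_i row_j g[symmetric] by (simp add: field_simps)
  then have lam: "lam * of_int (d * x) = of_int (int e * x)" for x
    by (simp add: mult.assoc[symmetric])
  have expo: "nat (int k * d) = k * g"
    "nat \<lfloor>lam * of_int (b i 0 + b i 1 - (int k + 1) * d)\<rfloor> = (p + q - 1 - k) * e"
    if "k \<in> {..p + q - 1}" for k
  proof -
    show "nat (int k * d) = k * g"
      unfolding g[symmetric] by (simp add: nat_mult_distrib)
    have "b i 0 + b i 1 - (int k + 1) * d = d * int (p + q - 1 - k)"
      unfolding sum using that pos by (simp add: algebra_simps of_nat_diff)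
    then have "\<lfloor>lam * of_int (b i 0 + b i 1 - (int k + 1) * d)\<rfloor> = int e * int (p + q - 1 - k)"
      unfolding lam by (simp only: lam floor_of_int)
    then show "nat \<lfloor>lam * of_int (b i 0 + b i 1 - (int k + 1) * d)\<rfloor> = (p + q - 1 - k) * e"
      by (simp add: nat_mult_distrib mult.commute)
  qed
  have "M = (\<lambda>k. monom (single i (nat (int k * d)) +
      single j (nat \<lfloor>lam * of_int (b i 0 + b i 1 - (int k + 1) * d)\<rfloor>))) ` {..p + q - 1}"
    unfolding M_def bound by blast
  also have "\<dots> = monom ` corners"
    unfolding corners_def image_image corner_def by (intro image_cong refl) (simp only: expo)
  finally have M: "M = monom ` corners" .
  show ?thesis
    unfolding M I_def P_def primary_eq_component
    using monom_in_component unfolding exps_def by blast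
qed

end
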